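(* Fix a basis function set of size $B$ and the initial state $s_0$. Then the following hold. (a) WTCA is equivalent to a linear program that is a relaxation of ALP, and it provides a valid upper bound on the optimal policy value $V_0^*(s_0)$: $$V_0^*(s_0)\;\le\;U_{\mathrm{WTCA},B}\;\le\;U_{\mathrm{ALP},B}.$$ (b) For optimal WTCA basis function weights $\beta^{\mathrm{WTCA}}\in\arg\min_{\beta\in\Omega}F_{\mathrm{WTCA}}(\beta)$, $$V_0^*(s_0)\;\le\;U_{\mathrm{PO},B}\;\le\;F_{\mathrm{PO}}(\beta^{\mathrm{WTCA}})\;\le\;U_{\mathrm{WTCA},B}.$$
   Context: MDP. Finite-horizon Markov decision process with stages $\mathcal{T}=\{0,1,\ldots,T-1\}$ and discount factor $\gamma\in(0,1)$. The state is $s_t=(x_t,w_t)\in\mathcal{S}_t=\mathcal{X}_t\times\mathcal{W}_t$, with endogenous component $x_t$ in a finite set $\mathcal{X}_t$ and exogenous component $w_t$ in a (possibly continuous) set $\mathcal{W}_t$. An action $a_t$ from a finite set $\mathcal{A}_t$ yields reward $r_t(s_t,a_t)$; then $x_{t+1}=h(x_t,a_t)$ deterministically, while $w_t$ evolves as a Markov process with law $\mu$ on trajectories $w=(w_0,\ldots,w_{T-1})$, independent of the actions. The initial state $s_0=(x_0,w_0)$ is a fixed singleton. $\mathbb{E}$ denotes expectation under $\mu$. A policy $\pi=(\pi_t)_{t}$ consists of maps $\pi_t:\mathcal{S}_t\to\mathcal{A}_t$, and $V_0^*(s_0)=\sup_\pi \mathbb{E}[\sum_{t=0}^{T-1}\gamma^t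 r_t(s_t,\pi_t(s_t))\mid s_0]$. Value function approximation. For each $t$, $\phi_t=(\phi_{t,1},\ldots,\phi_{t,B})$ is a vector of basis functions on $\mathcal{S}_t$; for $\beta=(\beta_0,\ldots,\beta_{T-1})\in\mathbb{R}^{BT}$ with $\beta_t\in\mathbb{R}^B$, $\hat V_{t,\beta}(s_t)=\sum_{b=1}^B\beta_{t,b}\phi_{t,b}(s_t)$, and $\hat V_{T,\beta}\equiv 0$. The feasible set $\Omega\subseteq\mathbb{R}^{BT}$ is a sufficiently large compact convex set whose interior contains the optimal solutions of the approximation models below. Bellman deviation: $\Delta_t(\beta;w_t)=\max_{(x_t,a_t)\in\mathcal{X}_t\times\mathcal{A}_t}\{r_t(s_t,a_t)+\gamma\,\mathbb{E}[\hat V_{t+1,\beta}(s_{t+1})\mid s_t,a_t]-\hat V_{t,\beta}(s_t)\}$, where $s_t=(x_t,w_t)$ and $s_{t+1}=(h(x_t,a_t),w_{t+1})$. ALP: $\min_{\beta\in\Omega}\hat V_{0,\beta}(s_0)$ subject to $\Delta_t(\beta;w_t)\le 0$ for all $t\in\mathcal{T}$, $w_t\in\mathcal{W}_t$; optimal value $U_{\mathrm{ALP},B}$. (This is a semi-infinite linear program in $\beta\in\Omega$; "linear program" allows infinitely many constraints/variables.) WTCA: $\min_{\beta\in\Omega}F_{\mathrm{WTCA}}(\beta)$, where $F_{\mathrm{WTCA}}(\beta)=\hat V_{0,\beta}(s_0)+\sum_{t=0}^{T-1}\gamma^t\,\mathbb{E}[\Delta_t(\beta;w_t)]$; optimal value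 $U_{\mathrm{WTCA},B}$. PO: $\min_{\beta\in\Omega}F_{\mathrm{PO}}(\beta)$, where $$F_{\mathrm{PO}}(\beta)=\mathbb{E}\Big[\max_{a\in\mathcal{A}}\sum_{t=0}^{T-1}\gamma^t\Big(r_t(s_t,a_t)-\gamma\big(\hat V_{t+1,\beta}(x_{t+1},w_{t+1})-\mathbb{E}[\hat V_{t+1,\beta}(x_{t+1},w_{t+1})\mid w_t]\big)\Big)\Big],$$ $\mathcal{A}=\mathcal{A}_0\times\cdots\times\mathcal{A}_{T-1}$, $a=(a_0,\ldots,a_{T-1})$, $x_{t+1}=h(x_t,a_t)$ (the maximization is performed for each realized trajectory $w$; the inner conditional expectation is over $w_{t+1}$ given $w_t$ with $x_{t+1}$ fixed); optimal value $U_{\mathrm{PO},B}$. A minimization problem is a relaxation of ALP if every ALP-feasible $\beta$ gives (possibly after adding auxiliary variables) a feasible point of it whose objective value is no larger than the ALP objective at $\beta$. *)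

theory Defs
  imports "HOL-Probability.Probability"
begin

section \<open>Minimization problems\<close>

record 'v min_problem =
  feasible :: "'v set"
  objective :: "'v \<Rightarrow> real"

text \<open>The value of an infeasible problem is \<open>\<infinity>\<close>.\<close>

definition opt_val :: "'v min_problem \<Rightarrow> ereal" where
  "opt_val P = (INF v\<in>feasible P. ereal (objective P v))"

definition argmin :: "'v min_problem \<Rightarrow> 'v set" where
  "argmin P = {v \<in> feasible P. \<forall>u\<in>feasible P. objective P v \<le> objective P u}"

text \<open>\<open>Q\<close> has the variables of \<open>P\<close> and auxiliary variables; minimizing out the latter gives
  exactly \<open>P\<close>.  In particular the optimal values agree, and optimal solutions of \<open>P\<close> are the
  projections of optimal solutions of \<open>Q\<close>.\<close>

definition equivalent_with_aux :: "'v min_problem \<Rightarrow> ('v \<times> 'u) min_problem \<Rightarrow> bool" where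
  "equivalent_with_aux P Q \<longleftrightarrow>
     (\<forall>v u. (v, u) \<in> feasible Q \<longrightarrow> v \<in> feasible P \<and> objective P v \<le> objective Q (v, u)) \<and>
     (\<forall>v\<in>feasible P. \<exists>u. (v, u) \<in> feasible Q \<and> objective Q (v, u) = objective P v)"

definition relaxation_with_aux :: "('v \<times> 'u) min_problem \<Rightarrow> 'v min_problem \<Rightarrow> bool" where
  "relaxation_with_aux Q P \<longleftrightarrow>
     (\<forall>v\<in>feasible P. \<exists>u. (v, u) \<in> feasible Q \<and> objective Q (v, u) \<le> objective P v)"

text \<open>Linear programs with possibly infinitely many constraints, whose variables are a vector
  \<open>v\<close> restricted to a given set \<open>\<Omega>\<close> and a family of functions \<open>\<theta>\<close> from a linear subspace
  \<open>\<Theta>\<close> of the space of all such families.\<close>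

definition lincomb ::
    "real \<Rightarrow> ('i \<Rightarrow> 'j \<Rightarrow> real) \<Rightarrow> real \<Rightarrow> ('i \<Rightarrow> 'j \<Rightarrow> real) \<Rightarrow> ('i \<Rightarrow> 'j \<Rightarrow> real)" where
  "lincomb c \<theta> d \<theta>' = (\<lambda>i j. c * \<theta> i j + d * \<theta>' i j)"

definition function_subspace :: "('i \<Rightarrow> 'j \<Rightarrow> real) set \<Rightarrow> bool" where
  "function_subspace \<Theta> \<longleftrightarrow>
     (\<lambda>i j. 0) \<in> \<Theta> \<and> (\<forall>c d. \<forall>\<theta>\<in>\<Theta>. \<forall>\<theta>'\<in>\<Theta>. lincomb c \<theta> d \<theta>' \<in> \<Theta>)"

definition linear_form_on ::
    "('i \<Rightarrow> 'j \<Rightarrow> real) set \<Rightarrow> ('v::real_vector \<times> ('i \<Rightarrow> 'j \<Rightarrow> real) \<Rightarrow> real) \<Rightarrow> bool" where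
  "linear_form_on \<Theta> f \<longleftrightarrow>
     (\<forall>c d v v'. \<forall>\<theta>\<in>\<Theta>. \<forall>\<theta>'\<in>\<Theta>.
        f (c *\<^sub>R v + d *\<^sub>R v', lincomb c \<theta> d \<theta>') = c * f (v, \<theta>) + d * f (v', \<theta>'))"

definition linear_program ::
    "'v::real_vector set \<Rightarrow> ('v \<times> ('i \<Rightarrow> 'j \<Rightarrow> real)) min_problem \<Rightarrow> bool" where
  "linear_program \<Omega> Q \<longleftrightarrow>
     (\<exists>\<Theta> C. function_subspace \<Theta> \<and>
        linear_form_on \<Theta> (objective Q) \<and>
        (\<forall>(g, d)\<in>C. linear_form_on \<Theta> g) \<and>
        feasible Q = {(v, \<theta>). v \<in> \<Omega> \<and> \<theta> \<in> \<Theta> \<and> (\<forall>(g, d)\<in>C. g (v, \<theta>) \<le> (d::real))})"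


section \<open>The decision process\<close>

text \<open>\<open>exo M t\<close> is the measurable space of exogenous states at stage \<open>t\<close>; only its space and
  sigma-algebra matter.  \<open>kernel M t w\<close> is the conditional law of the exogenous state at stage
  \<open>t + 1\<close> given the state \<open>w\<close> at stage \<open>t\<close>, and \<open>law M\<close> is the law of the trajectories.\<close>

record ('x, 'w, 'a) mdp =
  horizon :: nat
  discount :: real
  endo :: "nat \<Rightarrow> 'x set"
  exo :: "nat \<Rightarrow> 'w measure"
  acts :: "nat \<Rightarrow> 'a set"
  reward :: "nat \<Rightarrow> 'x \<times> 'w \<Rightarrow> 'a \<Rightarrow> real"
  next_x :: "'x \<Rightarrow> 'a \<Rightarrow> 'x"
  kernel :: "nat \<Rightarrow> 'w \<Rightarrow> 'w measure"
  law :: "(nat \<Rightarrow> 'w) measure"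
  init_x :: 'x
  init_w :: 'w

locale exo_mdp =
  fixes M :: "('x, 'w, 'a) mdp"
  assumes horizon_pos: "0 < horizon M"
    and discount_pos: "0 < discount M"
    and discount_less_1: "discount M < 1"
    and finite_endo: "\<And>t. t < horizon M \<Longrightarrow> finite (endo M t)"
    and finite_acts: "\<And>t. t < horizon M \<Longrightarrow> finite (acts M t)"
    and acts_nonempty: "\<And>t. t < horizon M \<Longrightarrow> acts M t \<noteq> {}"
    and init_x_in: "init_x M \<in> endo M 0"
    and init_w_in: "init_w M \<in> space (exo M 0)"
    and next_x_in: "\<And>t x a. Suc t < horizon M \<Longrightarrow> x \<in> endo M t \<Longrightarrow> a \<in> acts M t \<Longrightarrow>
                      next_x M x a \<in> endo M (Suc t)"
    and kernel_measurable: "\<And>t. Suc t < horizon M \<Longrightarrow>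
                      kernel M t \<in> exo M t \<rightarrow>\<^sub>M prob_algebra (exo M (Suc t))"
    and prob_law: "prob_space (law M)"
    and sets_law: "sets (law M) = sets (PiM {..<horizon M} (exo M))"
    and law_init: "AE w in law M. w 0 = init_w M"
    and markov: "\<And>t H E. Suc t < horizon M \<Longrightarrow>
                      H \<in> sets (PiM {..t} (exo M)) \<Longrightarrow> E \<in> sets (exo M (Suc t)) \<Longrightarrow>
                      measure (law M) {w \<in> space (law M). restrict w {..t} \<in> H \<and> w (Suc t) \<in> E} =
                      (\<integral>w. indicator H (restrict w {..t}) * measure (kernel M t (w t)) E \<partial>law M)"
    and reward_measurable: "\<And>t x a. t < horizon M \<Longrightarrow> x \<in> endo M t \<Longrightarrow> a \<in> acts M t \<Longrightarrow>
                      (\<lambda>w. reward M t (x, w) a) \<in> borel_measurable (exo M t)"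
    and reward_integrable: "\<And>t x a. t < horizon M \<Longrightarrow> x \<in> endo M t \<Longrightarrow> a \<in> acts M t \<Longrightarrow>
                      integrable (law M) (\<lambda>w. reward M t (x, w t) a)"

definition policies :: "('x, 'w, 'a) mdp \<Rightarrow> (nat \<Rightarrow> 'x \<times> 'w \<Rightarrow> 'a) set" where
  "policies M = {\<pi>. \<forall>t<horizon M. \<forall>x\<in>endo M t.
     (\<lambda>w. \<pi> t (x, w)) \<in> exo M t \<rightarrow>\<^sub>M count_space (acts M t)}"

primrec policy_path ::
    "('x, 'w, 'a) mdp \<Rightarrow> (nat \<Rightarrow> 'x \<times> 'w \<Rightarrow> 'a) \<Rightarrow> (nat \<Rightarrow> 'w) \<Rightarrow> nat \<Rightarrow> 'x" where
  "policy_path M \<pi> w 0 = init_x M"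
| "policy_path M \<pi> w (Suc t) =
     next_x M (policy_path M \<pi> w t) (\<pi> t (policy_path M \<pi> w t, w t))"

definition policy_value :: "('x, 'w, 'a) mdp \<Rightarrow> (nat \<Rightarrow> 'x \<times> 'w \<Rightarrow> 'a) \<Rightarrow> real" where
  "policy_value M \<pi> =
     (\<integral>w. (\<Sum>t<horizon M. discount M ^ t *
        (let s = (policy_path M \<pi> w t, w t) in reward M t s (\<pi> t s))) \<partial>law M)"

definition V0_opt :: "('x, 'w, 'a) mdp \<Rightarrow> ereal" where
  "V0_opt M = (SUP \<pi>\<in>policies M. ereal (policy_value M \<pi>))"

primrec action_path :: "('x, 'w, 'a) mdp \<Rightarrow> (nat \<Rightarrow> 'a) \<Rightarrow> nat \<Rightarrow> 'x" where
  "action_path M a 0 = init_x M"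
| "action_path M a (Suc t) = next_x M (action_path M a t) (a t)"


section \<open>Value function approximation\<close>

text \<open>With \<open>B\<close> basis functions and \<open>T\<close> stages, the weights live in \<open>(real ^ 'b) ^ 't\<close> with
  \<open>CARD('b) = B\<close> and \<open>CARD('t) = T\<close>; the bijection \<open>\<tau>\<close> says which coordinate belongs to which
  stage.\<close>

locale vfa = exo_mdp M
  for M :: "('x, 'w, 'a) mdp" +
  fixes \<tau> :: "nat \<Rightarrow> 't::finite"
    and \<phi> :: "nat \<Rightarrow> 'b::finite \<Rightarrow> 'x \<times> 'w \<Rightarrow> real"
  assumes stage_bij: "bij_betw \<tau> {..<horizon M} UNIV"
    and basis_measurable: "\<And>t b x. t < horizon M \<Longrightarrow> x \<in> endo M t \<Longrightarrow>
          (\<lambda>w. \<phi> t b (x, w)) \<in> borel_measurable (exo M t)"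
    and basis_integrable: "\<And>t b x. t < horizon M \<Longrightarrow> x \<in> endo M t \<Longrightarrow>
          integrable (law M) (\<lambda>w. \<phi> t b (x, w t))"
    and basis_kernel_integrable: "\<And>t b x w. Suc t < horizon M \<Longrightarrow> x \<in> endo M (Suc t) \<Longrightarrow>
          w \<in> space (exo M t) \<Longrightarrow> integrable (kernel M t w) (\<lambda>w'. \<phi> (Suc t) b (x, w'))"

definition Vhat :: "('x, 'w, 'a) mdp \<Rightarrow> (nat \<Rightarrow> 't) \<Rightarrow> (nat \<Rightarrow> 'b \<Rightarrow> 'x \<times> 'w \<Rightarrow> real)
    \<Rightarrow> (real ^ 'b::finite) ^ 't::finite \<Rightarrow> nat \<Rightarrow> 'x \<times> 'w \<Rightarrow> real" where
  "Vhat M \<tau> \<phi> \<beta> t s = (if t < horizon M then \<Sum>b\<in>UNIV. \<beta> $ \<tau> t $ b * \<phi> t b s else 0)"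

text \<open>The conditional expectation of the approximate value at stage \<open>t + 1\<close>, with endogenous
  state \<open>x'\<close>, given the exogenous state \<open>w\<close> at stage \<open>t\<close>.\<close>

definition EVhat :: "('x, 'w, 'a) mdp \<Rightarrow> (nat \<Rightarrow> 't) \<Rightarrow> (nat \<Rightarrow> 'b \<Rightarrow> 'x \<times> 'w \<Rightarrow> real)
    \<Rightarrow> (real ^ 'b::finite) ^ 't::finite \<Rightarrow> nat \<Rightarrow> 'x \<Rightarrow> 'w \<Rightarrow> real" where
  "EVhat M \<tau> \<phi> \<beta> t x' w = (\<integral>w'. Vhat M \<tau> \<phi> \<beta> (Suc t) (x', w') \<partial>kernel M t w)"

definition bellman_residual :: "('x, 'w, 'a) mdp \<Rightarrow> (nat \<Rightarrow> 't) \<Rightarrow> (nat \<Rightarrow> 'b \<Rightarrow> 'x \<times> 'w \<Rightarrow> real)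
    \<Rightarrow> (real ^ 'b::finite) ^ 't::finite \<Rightarrow> nat \<Rightarrow> 'x \<Rightarrow> 'a \<Rightarrow> 'w \<Rightarrow> real" where
  "bellman_residual M \<tau> \<phi> \<beta> t x a w =
     reward M t (x, w) a + discount M * EVhat M \<tau> \<phi> \<beta> t (next_x M x a) w
       - Vhat M \<tau> \<phi> \<beta> t (x, w)"

definition bellman_deviation :: "('x, 'w, 'a) mdp \<Rightarrow> (nat \<Rightarrow> 't) \<Rightarrow> (nat \<Rightarrow> 'b \<Rightarrow> 'x \<times> 'w \<Rightarrow> real)
    \<Rightarrow> (real ^ 'b::finite) ^ 't::finite \<Rightarrow> nat \<Rightarrow> 'w \<Rightarrow> real" where
  "bellman_deviation M \<tau> \<phi> \<beta> t w =
     Max ((\<lambda>(x, a). bellman_residual M \<tau> \<phi> \<beta> t x a w) ` (endo M t \<times> acts M t))"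


section \<open>Approximation models\<close>

definition ALP :: "('x, 'w, 'a) mdp \<Rightarrow> (nat \<Rightarrow> 't) \<Rightarrow> (nat \<Rightarrow> 'b \<Rightarrow> 'x \<times> 'w \<Rightarrow> real)
    \<Rightarrow> ((real ^ 'b::finite) ^ 't::finite) set \<Rightarrow> ((real ^ 'b) ^ 't) min_problem" where
  "ALP M \<tau> \<phi> \<Omega> =
     \<lparr>feasible = {\<beta> \<in> \<Omega>. \<forall>t<horizon M. \<forall>w\<in>space (exo M t). bellman_deviation M \<tau> \<phi> \<beta> t w \<le> 0},
      objective = (\<lambda>\<beta>. Vhat M \<tau> \<phi> \<beta> 0 (init_x M, init_w M))\<rparr>"

definition F_WTCA :: "('x, 'w, 'a) mdp \<Rightarrow> (nat \<Rightarrow> 't) \<Rightarrow> (nat \<Rightarrow> 'b \<Rightarrow> 'x \<times> 'w \<Rightarrow> real)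
    \<Rightarrow> (real ^ 'b::finite) ^ 't::finite \<Rightarrow> real" where
  "F_WTCA M \<tau> \<phi> \<beta> =
     Vhat M \<tau> \<phi> \<beta> 0 (init_x M, init_w M)
       + (\<Sum>t<horizon M. discount M ^ t * (\<integral>w. bellman_deviation M \<tau> \<phi> \<beta> t (w t) \<partial>law M))"

definition WTCA :: "('x, 'w, 'a) mdp \<Rightarrow> (nat \<Rightarrow> 't) \<Rightarrow> (nat \<Rightarrow> 'b \<Rightarrow> 'x \<times> 'w \<Rightarrow> real)
    \<Rightarrow> ((real ^ 'b::finite) ^ 't::finite) set \<Rightarrow> ((real ^ 'b) ^ 't) min_problem" where
  "WTCA M \<tau> \<phi> \<Omega> = \<lparr>feasible = \<Omega>, objective = F_WTCA M \<tau> \<phi>\<rparr>"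

definition F_PO :: "('x, 'w, 'a) mdp \<Rightarrow> (nat \<Rightarrow> 't) \<Rightarrow> (nat \<Rightarrow> 'b \<Rightarrow> 'x \<times> 'w \<Rightarrow> real)
    \<Rightarrow> (real ^ 'b::finite) ^ 't::finite \<Rightarrow> real" where
  "F_PO M \<tau> \<phi> \<beta> =
     (\<integral>w. Max ((\<lambda>a. \<Sum>t<horizon M. discount M ^ t *
             (reward M t (action_path M a t, w t) (a t)
              - discount M * (Vhat M \<tau> \<phi> \<beta> (Suc t) (action_path M a (Suc t), w (Suc t))
                              - EVhat M \<tau> \<phi> \<beta> t (action_path M a (Suc t)) (w t))))
           ` (\<Pi>\<^sub>E t\<in>{..<horizon M}. acts M t)) \<partial>law M)"

definition PO :: "('x, 'w, 'a) mdp \<Rightarrow> (nat \<Rightarrow> 't) \<Rightarrow> (nat \<Rightarrow> 'b \<Rightarrow> 'x \<times> 'w \<Rightarrow> real)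
    \<Rightarrow> ((real ^ 'b::finite) ^ 't::finite) set \<Rightarrow> ((real ^ 'b) ^ 't) min_problem" where
  "PO M \<tau> \<phi> \<Omega> = \<lparr>feasible = \<Omega>, objective = F_PO M \<tau> \<phi>\<rparr>"

text \<open>WTCA written with one slack variable \<open>\<theta> t w\<close> per stage and exogenous state: the maximum in
  the Bellman deviation becomes a family of linear constraints.\<close>

definition slack_space :: "('x, 'w, 'a) mdp \<Rightarrow> (nat \<Rightarrow> 'w \<Rightarrow> real) set" where
  "slack_space M = {\<theta>. \<forall>t<horizon M.
     \<theta> t \<in> borel_measurable (exo M t) \<and> integrable (law M) (\<lambda>w. \<theta> t (w t))}"

definition WTCA_LP :: "('x, 'w, 'a) mdp \<Rightarrow> (nat \<Rightarrow> 't) \<Rightarrow> (nat \<Rightarrow> 'b \<Rightarrow> 'x \<times> 'w \<Rightarrow> real)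
    \<Rightarrow> ((real ^ 'b::finite) ^ 't::finite) set
    \<Rightarrow> (((real ^ 'b) ^ 't) \<times> (nat \<Rightarrow> 'w \<Rightarrow> real)) min_problem" where
  "WTCA_LP M \<tau> \<phi> \<Omega> =
     \<lparr>feasible = {(\<beta>, \<theta>). \<beta> \<in> \<Omega> \<and> \<theta> \<in> slack_space M \<and>
        (\<forall>t<horizon M. \<forall>w\<in>space (exo M t). \<forall>x\<in>endo M t. \<forall>a\<in>acts M t.
           bellman_residual M \<tau> \<phi> \<beta> t x a w \<le> \<theta> t w)},
      objective = (\<lambda>(\<beta>, \<theta>). Vhat M \<tau> \<phi> \<beta> 0 (init_x M, init_w M)
        + (\<Sum>t<horizon M. discount M ^ t * (\<integral>w. \<theta> t (w t) \<partial>law M)))\<rparr>"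

text \<open>A sufficiently large parameter set contains in its interior an optimal solution of each model
  over the whole parameter space, whenever there is one.  It cannot be asked to contain all of
  them: the objective of PO does not depend on the weights of stage 0, so its set of optimal
  solutions is unbounded when nonempty.\<close>

definition admissible_parameter_set ::
    "('x, 'w, 'a) mdp \<Rightarrow> (nat \<Rightarrow> 't) \<Rightarrow> (nat \<Rightarrow> 'b \<Rightarrow> 'x \<times> 'w \<Rightarrow> real)
    \<Rightarrow> ((real ^ 'b::finite) ^ 't::finite) set \<Rightarrow> bool" where
  "admissible_parameter_set M \<tau> \<phi> \<Omega> \<longleftrightarrow>
     compact \<Omega> \<and> convex \<Omega> \<and> \<Omega> \<noteq> {} \<and>
     (\<forall>P\<in>{ALP M \<tau> \<phi> UNIV, WTCA M \<tau> \<phi> UNIV, PO M \<tau> \<phi> UNIV}.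
        argmin P \<noteq> {} \<longrightarrow> argmin P \<inter> interior \<Omega> \<noteq> {})"

end

(* Along any policy the penalty in PO is a martingale difference, so subtracting it leaves the
   value of the policy unchanged, while maximizing over all action sequences for each trajectory
   can only increase the payoff: the policy value is at most F_PO.  Telescoping the approximate
   values along a trajectory turns the penalized payoff into V_0(s_0) plus the discounted Bellman
   residuals, each of which is at most the Bellman deviation of its stage: F_PO is at most F_WTCA.
   Deviations are nonpositive at ALP-feasible weights, where therefore F_WTCA is at most the ALP
   objective.  The optimal slack variables of the linear program are the Bellman deviations. *)

theory Submission
  imports Defs
begin

lemma measurable_finite_choice:
  assumes "finite I" "X \<in> N \<rightarrow>\<^sub>M count_space I" "\<And>i. i \<in> I \<Longrightarrow> f i \<in> N \<rightarrow>\<^sub>M L"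
  shows "(\<lambda>w. f (X w) w) \<in> N \<rightarrow>\<^sub>M L"
  by (rule measurable_compose_countable'[OF assms(3,2) countable_finite[OF assms(1)]])

lemma integrable_finite_choice:
  fixes f :: "'i \<Rightarrow> 'w \<Rightarrow> real"
  assumes "finite I" "X \<in> N \<rightarrow>\<^sub>M count_space I" "\<And>i. i \<in> I \<Longrightarrow> integrable N (f i)"
  shows "integrable N (\<lambda>w. f (X w) w)"
proof (rule Bochner_Integration.integrable_bound)
  show "integrable N (\<lambda>w. \<Sum>i\<in>I. \<bar>f i w\<bar>)"
    using assms(3) by (intro Bochner_Integration.integrable_sum integrable_abs)
  show "(\<lambda>w. f (X w) w) \<in> borel_measurable N"
    by (rule measurable_finite_choice[OF assms(1,2)]) (rule borel_measurable_integrable[OF assms(3)])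
  show "AE w in N. norm (f (X w) w) \<le> norm (\<Sum>i\<in>I. \<bar>f i w\<bar>)"
  proof (rule AE_I2)
    fix w assume "w \<in> space N"
    then have "X w \<in> I"
      using measurable_space[OF assms(2)] by simp
    then have "\<bar>f (X w) w\<bar> \<le> (\<Sum>i\<in>I. \<bar>f i w\<bar>)"
      using assms(1) by (intro member_le_sum) auto
    then show "norm (f (X w) w) \<le> norm (\<Sum>i\<in>I. \<bar>f i w\<bar>)"
      by simp
  qed
qed

context exo_mdp
begin

interpretation law: prob_space "law M"
  by (rule prob_law)

lemma measurable_stage: "t < horizon M \<Longrightarrow> (\<lambda>w. w t) \<in> law M \<rightarrow>\<^sub>M exo M t"
  unfolding measurable_cong_sets[OF sets_law refl] by (rule measurable_component_singleton) simp

lemma law_stage_in: "t < horizon M \<Longrightarrow> w \<in> space (law M) \<Longrightarrow> w t \<in> space (exo M t)"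
  using measurable_space[OF measurable_stage] .

lemma measurable_history:
  "t < horizon M \<Longrightarrow> (\<lambda>w. restrict w {..t}) \<in> law M \<rightarrow>\<^sub>M PiM {..t} (exo M)"
  unfolding measurable_cong_sets[OF sets_law refl] by (rule measurable_restrict_subset) auto

lemma history_event:
  assumes "t < horizon M" "H \<in> sets (PiM {..t} (exo M))"
  shows "{w \<in> space (law M). restrict w {..t} \<in> H} \<in> sets (law M)"
  using measurable_sets[OF measurable_history assms(2)] assms(1)
  by (simp add: vimage_def Int_def conj_commute)

lemma endo_nonempty: "t < horizon M \<Longrightarrow> endo M t \<noteq> {}"
proof (induction t)
  case 0
  then show ?case using init_x_in by auto
next
  case (Suc t)
  then have "endo M t \<noteq> {}" "acts M t \<noteq> {}"
    using acts_nonempty[of t] by auto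
  then obtain x a where "x \<in> endo M t" "a \<in> acts M t"
    by auto
  from next_x_in[OF Suc.prems this] show ?case
    by auto
qed

lemma measurable_kernel:
  "Suc t < horizon M \<Longrightarrow> kernel M t \<in> exo M t \<rightarrow>\<^sub>M subprob_algebra (exo M (Suc t))"
  by (rule measurable_prob_algebraD[OF kernel_measurable])

lemma measurable_kernel_law:
  "Suc t < horizon M \<Longrightarrow> (\<lambda>w. kernel M t (w t)) \<in> law M \<rightarrow>\<^sub>M subprob_algebra (exo M (Suc t))"
  by (rule measurable_compose[OF measurable_stage measurable_kernel]) auto

lemma kernel_props:
  assumes "Suc t < horizon M" "w \<in> space (exo M t)"
  shows "prob_space (kernel M t w)" "sets (kernel M t w) = sets (exo M (Suc t))"
  using measurable_space[OF kernel_measurable[OF assms(1)] assms(2)]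
  by (auto simp: space_prob_algebra)

text \<open>The Markov hypothesis says that, on a history event, the law of the next exogenous state is
  the history law bound to the kernel; as an identity of measures it extends to all integrands.\<close>

lemma transition_nn_integral:
  assumes t: "Suc t < horizon M"
    and H: "H \<in> sets (PiM {..t} (exo M))"
    and g: "g \<in> borel_measurable (exo M (Suc t))"
  defines "A \<equiv> {w \<in> space (law M). restrict w {..t} \<in> H}"
  shows "(\<integral>\<^sup>+w. indicator A w * g (w (Suc t)) \<partial>law M) =
         (\<integral>\<^sup>+w. indicator A w * (\<integral>\<^sup>+w'. g w' \<partial>kernel M t (w t)) \<partial>law M)"
proof -
  have A: "A \<in> sets (law M)"
    unfolding A_def by (rule history_event[OF _ H]) (use t in simp)
  let ?D = "density (law M) (indicator A)"
  have ind: "(indicator A :: _ \<Rightarrow> ennreal) \<in> borel_measurable (law M)"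
    using A by simp
  have Suc_t: "(\<lambda>w. w (Suc t)) \<in> ?D \<rightarrow>\<^sub>M exo M (Suc t)"
    using measurable_stage[OF t] by simp
  have K: "(\<lambda>w. kernel M t (w t)) \<in> ?D \<rightarrow>\<^sub>M subprob_algebra (exo M (Suc t))"
    using measurable_kernel_law[OF t] by simp
  have ne: "space ?D \<noteq> {}"
    using law.not_empty by simp
  have "distr ?D (exo M (Suc t)) (\<lambda>w. w (Suc t)) = ?D \<bind> (\<lambda>w. kernel M t (w t))"
  proof (rule measure_eqI)
    show "sets (distr ?D (exo M (Suc t)) (\<lambda>w. w (Suc t))) = sets (?D \<bind> (\<lambda>w. kernel M t (w t)))"
      by (subst sets_bind[OF _ ne, where N = "exo M (Suc t)"])
        (use kernel_props(2)[OF t law_stage_in] t in auto)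
  next
    fix E assume "E \<in> sets (distr ?D (exo M (Suc t)) (\<lambda>w. w (Suc t)))"
    then have E: "E \<in> sets (exo M (Suc t))"
      by simp
    have KE: "(\<lambda>w. emeasure (kernel M t (w t)) E) \<in> borel_measurable (law M)"
      by (rule measurable_compose[OF measurable_kernel_law[OF t]])
        (rule measurable_emeasure_subprob_algebra[OF E])
    have KE': "(\<lambda>w. measure (kernel M t (w t)) E) \<in> borel_measurable (law M)"
      using KE unfolding measure_def by simp
    have pre: "(\<lambda>w. w (Suc t)) -` E \<inter> space (law M) \<in> sets (law M)"
      by (rule measurable_sets[OF measurable_stage[OF t] E])
    have bnd: "measure (kernel M t (w t)) E \<le> 1" if "w \<in> space (law M)" for w
      using prob_space.prob_le_1[OF kernel_props(1)[OF t law_stage_in]] that t by auto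
    have int: "integrable (law M) (\<lambda>w. indicator A w * measure (kernel M t (w t)) E)"
      using A KE' bnd
      by (intro law.integrable_const_bound[where B = 1]) (auto simp: indicator_def)
    have "emeasure (distr ?D (exo M (Suc t)) (\<lambda>w. w (Suc t))) E =
        emeasure ?D ((\<lambda>w. w (Suc t)) -` E \<inter> space (law M))"
      using emeasure_distr[OF Suc_t E] by simp
    also have "\<dots> = emeasure (law M) (A \<inter> ((\<lambda>w. w (Suc t)) -` E \<inter> space (law M)))"
      using emeasure_density[OF ind pre] A pre
      by (simp flip: indicator_inter_arith add: nn_integral_indicator)
    also have "A \<inter> ((\<lambda>w. w (Suc t)) -` E \<inter> space (law M)) =
        {w \<in> space (law M). restrict w {..t} \<in> H \<and> w (Suc t) \<in> E}"
      by (auto simp: A_def)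
    also have "emeasure (law M) \<dots> =
        ennreal (\<integral>w. indicator H (restrict w {..t}) * measure (kernel M t (w t)) E \<partial>law M)"
      using markov[OF t H E] law.emeasure_eq_measure by simp
    also have "(\<integral>w. indicator H (restrict w {..t}) * measure (kernel M t (w t)) E \<partial>law M) =
        (\<integral>w. indicator A w * measure (kernel M t (w t)) E \<partial>law M)"
      by (rule Bochner_Integration.integral_cong) (auto simp: A_def indicator_def)
    also have "ennreal \<dots> = (\<integral>\<^sup>+w. ennreal (indicator A w * measure (kernel M t (w t)) E) \<partial>law M)"
      by (rule nn_integral_eq_integral[OF int, symmetric]) auto
    also have "\<dots> = (\<integral>\<^sup>+w. indicator A w * emeasure (kernel M t (w t)) E \<partial>law M)"
    proof (rule nn_integral_cong)
      fix w assume "w \<in> space (law M)"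
      then interpret k: prob_space "kernel M t (w t)"
        using kernel_props(1)[OF t law_stage_in] t by auto
      show "ennreal (indicator A w * measure (kernel M t (w t)) E) =
          indicator A w * emeasure (kernel M t (w t)) E"
        by (auto simp: indicator_def k.emeasure_eq_measure)
    qed
    also have "\<dots> = (\<integral>\<^sup>+w. emeasure (kernel M t (w t)) E \<partial>?D)"
      by (rule nn_integral_density[OF ind KE, symmetric])
    also have "\<dots> = emeasure (?D \<bind> (\<lambda>w. kernel M t (w t))) E"
      by (rule emeasure_bind[OF ne K E, symmetric])
    finally show "emeasure (distr ?D (exo M (Suc t)) (\<lambda>w. w (Suc t))) E =
        emeasure (?D \<bind> (\<lambda>w. kernel M t (w t))) E" .
  qed
  then have "(\<integral>\<^sup>+w. g w \<partial>distr ?D (exo M (Suc t)) (\<lambda>w. w (Suc t))) =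
      (\<integral>\<^sup>+w. g w \<partial>(?D \<bind> (\<lambda>w. kernel M t (w t))))"
    by simp
  moreover have "(\<lambda>w. g (w (Suc t))) \<in> borel_measurable (law M)"
    by (rule measurable_compose[OF measurable_stage[OF t] g])
  moreover have "(\<lambda>w. \<integral>\<^sup>+w'. g w' \<partial>kernel M t (w t)) \<in> borel_measurable (law M)"
    by (rule measurable_compose[OF measurable_kernel_law[OF t]])
      (rule nn_integral_measurable_subprob_algebra[OF g])
  ultimately show ?thesis
    by (simp add: nn_integral_distr[OF Suc_t] g nn_integral_bind[OF g K] nn_integral_density[OF ind])
qed

lemma measurable_transition:
  fixes g :: "'w \<Rightarrow> real"
  assumes "Suc t < horizon M" "g \<in> borel_measurable (exo M (Suc t))"
  shows "(\<lambda>w. \<integral>w'. g w' \<partial>kernel M t w) \<in> borel_measurable (exo M t)"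
  by (rule measurable_compose[OF measurable_kernel[OF assms(1)]])
    (rule integral_measurable_subprob_algebra[OF assms(2)])

lemma transition_integral_nonneg:
  fixes g :: "'w \<Rightarrow> real"
  assumes t: "Suc t < horizon M"
    and H: "H \<in> sets (PiM {..t} (exo M))"
    and g: "g \<in> borel_measurable (exo M (Suc t))"
    and pos: "\<And>w. 0 \<le> g w"
    and int: "integrable (law M) (\<lambda>w. g (w (Suc t)))"
    and k_int: "\<And>w. w \<in> space (exo M t) \<Longrightarrow> integrable (kernel M t w) g"
  defines "A \<equiv> {w \<in> space (law M). restrict w {..t} \<in> H}"
  shows "integrable (law M) (\<lambda>w. indicator A w * (\<integral>w'. g w' \<partial>kernel M t (w t)))" (is ?I)
    and "(\<integral>w. indicator A w * g (w (Suc t)) \<partial>law M) =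
         (\<integral>w. indicator A w * (\<integral>w'. g w' \<partial>kernel M t (w t)) \<partial>law M)" (is ?E)
proof -
  have A: "A \<in> sets (law M)"
    unfolding A_def by (rule history_event[OF _ H]) (use t in simp)
  have kpos: "0 \<le> (\<integral>w'. g w' \<partial>kernel M t w)" for w
    using pos by simp
  have int': "integrable (law M) (\<lambda>w. indicator A w * g (w (Suc t)))"
    using integrable_real_mult_indicator[OF A int] by (simp add: mult.commute)
  have "ennreal (\<integral>w. indicator A w * g (w (Suc t)) \<partial>law M) =
      (\<integral>\<^sup>+w. indicator A w * ennreal (g (w (Suc t))) \<partial>law M)"
    by (subst nn_integral_eq_integral[OF int', symmetric])
      (auto simp: pos indicator_def intro!: nn_integral_cong)
  also have "\<dots> = (\<integral>\<^sup>+w. indicator A w * (\<integral>\<^sup>+w'. ennreal (g w') \<partial>kernel M t (w t)) \<partial>law M)"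
    unfolding A_def by (rule transition_nn_integral[OF t H]) (use g in simp)
  also have "\<dots> = (\<integral>\<^sup>+w. ennreal (indicator A w * (\<integral>w'. g w' \<partial>kernel M t (w t))) \<partial>law M)"
    using t by (intro nn_integral_cong)
      (auto simp: indicator_def pos nn_integral_eq_integral[OF k_int] law_stage_in)
  finally have eq: "(\<integral>\<^sup>+w. ennreal (indicator A w * (\<integral>w'. g w' \<partial>kernel M t (w t))) \<partial>law M) =
      ennreal (\<integral>w. indicator A w * g (w (Suc t)) \<partial>law M)" ..
  have meas: "(\<lambda>w. indicator A w * (\<integral>w'. g w' \<partial>kernel M t (w t))) \<in> borel_measurable (law M)"
    using A measurable_compose[OF measurable_stage measurable_transition[OF t g]] t by auto
  show ?I
    by (rule integrableI_nn_integral_finite[OF meas _ eq]) (auto simp: kpos)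
  then show ?E
    using eq by (subst (asm) nn_integral_eq_integral) (auto simp: kpos pos)
qed

lemma transition_integral:
  fixes g :: "'w \<Rightarrow> real"
  assumes t: "Suc t < horizon M"
    and H: "H \<in> sets (PiM {..t} (exo M))"
    and g: "g \<in> borel_measurable (exo M (Suc t))"
    and int: "integrable (law M) (\<lambda>w. g (w (Suc t)))"
    and k_int: "\<And>w. w \<in> space (exo M t) \<Longrightarrow> integrable (kernel M t w) g"
  defines "A \<equiv> {w \<in> space (law M). restrict w {..t} \<in> H}"
  shows "integrable (law M) (\<lambda>w. indicator A w * (\<integral>w'. g w' \<partial>kernel M t (w t)))" (is ?I)
    and "(\<integral>w. indicator A w * g (w (Suc t)) \<partial>law M) =
         (\<integral>w. indicator A w * (\<integral>w'. g w' \<partial>kernel M t (w t)) \<partial>law M)" (is ?E)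
proof -
  have A: "A \<in> sets (law M)"
    unfolding A_def by (rule history_event[OF _ H]) (use t in simp)
  let ?p = "\<lambda>w. max 0 (g w)" and ?n = "\<lambda>w. max 0 (- g w)"
  have p: "?p \<in> borel_measurable (exo M (Suc t))" "\<And>w. 0 \<le> ?p w"
      "integrable (law M) (\<lambda>w. ?p (w (Suc t)))"
      "\<And>w. w \<in> space (exo M t) \<Longrightarrow> integrable (kernel M t w) ?p"
    and n: "?n \<in> borel_measurable (exo M (Suc t))" "\<And>w. 0 \<le> ?n w"
      "integrable (law M) (\<lambda>w. ?n (w (Suc t)))"
      "\<And>w. w \<in> space (exo M t) \<Longrightarrow> integrable (kernel M t w) ?n"
    using g int k_int by (auto intro: borel_measurable_max integrable_max)
  have P: "integrable (law M) (\<lambda>w. indicator A w * (\<integral>w'. ?p w' \<partial>kernel M t (w t)))"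
    "(\<integral>w. indicator A w * ?p (w (Suc t)) \<partial>law M) =
     (\<integral>w. indicator A w * (\<integral>w'. ?p w' \<partial>kernel M t (w t)) \<partial>law M)"
    and N: "integrable (law M) (\<lambda>w. indicator A w * (\<integral>w'. ?n w' \<partial>kernel M t (w t)))"
    "(\<integral>w. indicator A w * ?n (w (Suc t)) \<partial>law M) =
     (\<integral>w. indicator A w * (\<integral>w'. ?n w' \<partial>kernel M t (w t)) \<partial>law M)"
    by ((rule transition_integral_nonneg[OF t H p, folded A_def]
          transition_integral_nonneg[OF t H n, folded A_def], assumption)+)
  have ip: "integrable (law M) (\<lambda>w. indicator A w * ?p (w (Suc t)))"
    "integrable (law M) (\<lambda>w. indicator A w * ?n (w (Suc t)))"
    using integrable_real_mult_indicator[OF A p(3)] integrable_real_mult_indicator[OF A n(3)]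
    unfolding mult.commute[of _ "indicator A _"] by this+
  have split_k: "indicator A w * (\<integral>w'. g w' \<partial>kernel M t (w t)) =
      indicator A w * (\<integral>w'. ?p w' \<partial>kernel M t (w t)) -
      indicator A w * (\<integral>w'. ?n w' \<partial>kernel M t (w t))" if "w \<in> space (law M)" for w
  proof -
    have k: "integrable (kernel M t (w t)) g"
      using k_int law_stage_in that t by auto
    have "(\<integral>w'. g w' \<partial>kernel M t (w t)) = (\<integral>w'. ?p w' - ?n w' \<partial>kernel M t (w t))"
      by (rule Bochner_Integration.integral_cong) auto
    also have "\<dots> = (\<integral>w'. ?p w' \<partial>kernel M t (w t)) - (\<integral>w'. ?n w' \<partial>kernel M t (w t))"
      using k by (intro Bochner_Integration.integral_diff) auto
    finally show ?thesis
      by (simp add: right_diff_distrib)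
  qed
  show ?I
    using Bochner_Integration.integrable_diff[OF P(1) N(1)]
    by (simp add: split_k cong: Bochner_Integration.integrable_cong)
  have "(\<integral>w. indicator A w * g (w (Suc t)) \<partial>law M) =
      (\<integral>w. indicator A w * ?p (w (Suc t)) - indicator A w * ?n (w (Suc t)) \<partial>law M)"
    by (rule Bochner_Integration.integral_cong) (auto simp: indicator_def)
  also have "\<dots> = (\<integral>w. indicator A w * (\<integral>w'. ?p w' \<partial>kernel M t (w t)) -
      indicator A w * (\<integral>w'. ?n w' \<partial>kernel M t (w t)) \<partial>law M)"
    by (simp only: Bochner_Integration.integral_diff[OF ip] P(2) N(2)
        Bochner_Integration.integral_diff[OF P(1) N(1)])
  also have "\<dots> = (\<integral>w. indicator A w * (\<integral>w'. g w' \<partial>kernel M t (w t)) \<partial>law M)"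
    by (rule Bochner_Integration.integral_cong) (auto simp: split_k)
  finally show ?E .
qed

lemma measurable_policy_path:
  assumes pol: "\<pi> \<in> policies M" and t: "t < horizon M" and I: "{..<t} \<subseteq> I"
  shows "(\<lambda>w. policy_path M \<pi> w t) \<in> PiM I (exo M) \<rightarrow>\<^sub>M count_space (endo M t)"
  using t I
proof (induction t)
  case 0
  then show ?case using init_x_in by simp
next
  case (Suc t)
  then have t: "t < horizon M" "t \<in> I" and IH:
    "(\<lambda>w. policy_path M \<pi> w t) \<in> PiM I (exo M) \<rightarrow>\<^sub>M count_space (endo M t)"
    by (auto simp: lessThan_Suc)
  have "(\<lambda>w. next_x M x (\<pi> t (x, w t))) \<in> PiM I (exo M) \<rightarrow>\<^sub>M count_space (endo M (Suc t))"
    if x: "x \<in> endo M t" for x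
  proof -
    have "(\<lambda>w. \<pi> t (x, w)) \<in> exo M t \<rightarrow>\<^sub>M count_space (acts M t)"
      using pol t x by (auto simp: policies_def)
    moreover have "(\<lambda>w. w t) \<in> PiM I (exo M) \<rightarrow>\<^sub>M exo M t"
      by (rule measurable_component_singleton[OF t(2)])
    ultimately have "(\<lambda>w. \<pi> t (x, w t)) \<in> PiM I (exo M) \<rightarrow>\<^sub>M count_space (acts M t)"
      by (rule measurable_compose[rotated])
    then show ?thesis
      by (rule measurable_compose) (use next_x_in[OF Suc.prems(1) x] in auto)
  qed
  from measurable_finite_choice[OF finite_endo[OF t(1)] IH this] show ?case
    by simp
qed

lemma measurable_policy_action:
  assumes pol: "\<pi> \<in> policies M" and t: "t < horizon M" and I: "{..t} \<subseteq> I"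
  shows "(\<lambda>w. \<pi> t (policy_path M \<pi> w t, w t)) \<in> PiM I (exo M) \<rightarrow>\<^sub>M count_space (acts M t)"
proof (rule measurable_finite_choice[OF finite_endo[OF t]])
  show "(\<lambda>w. policy_path M \<pi> w t) \<in> PiM I (exo M) \<rightarrow>\<^sub>M count_space (endo M t)"
    using I by (intro measurable_policy_path[OF pol t]) auto
  show "(\<lambda>w. \<pi> t (x, w t)) \<in> PiM I (exo M) \<rightarrow>\<^sub>M count_space (acts M t)" if "x \<in> endo M t" for x
  proof -
    have "(\<lambda>w. w t) \<in> PiM I (exo M) \<rightarrow>\<^sub>M exo M t"
      by (rule measurable_component_singleton) (use I in auto)
    moreover have "(\<lambda>w. \<pi> t (x, w)) \<in> exo M t \<rightarrow>\<^sub>M count_space (acts M t)"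
      using pol t that by (simp add: policies_def)
    ultimately show ?thesis
      by (rule measurable_compose)
  qed
qed

lemma policy_path_cong:
  "(\<And>s. s < t \<Longrightarrow> w s = w' s) \<Longrightarrow> policy_path M \<pi> w t = policy_path M \<pi> w' t"
  by (induction t) auto

lemma action_path_cong:
  "(\<And>s. s < t \<Longrightarrow> a s = a' s) \<Longrightarrow> action_path M a t = action_path M a' t"
  by (induction t) auto

lemma action_path_policy:
  "action_path M (\<lambda>t. \<pi> t (policy_path M \<pi> w t, w t)) t = policy_path M \<pi> w t"
  by (induction t) auto

lemma action_path_in:
  "a \<in> (\<Pi>\<^sub>E t\<in>{..<horizon M}. acts M t) \<Longrightarrow> t < horizon M \<Longrightarrow> action_path M a t \<in> endo M t"
proof (induction t)
  case 0
  then show ?case using init_x_in by simp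
next
  case (Suc t)
  then show ?case
    using PiE_mem[OF Suc.prems(1), of t] by (simp add: next_x_in)
qed

end


context vfa
begin

interpretation law: prob_space "law M"
  by (rule prob_law)

abbreviation "V \<equiv> Vhat M \<tau> \<phi>"
abbreviation "EV \<equiv> EVhat M \<tau> \<phi>"
abbreviation "residual \<equiv> bellman_residual M \<tau> \<phi>"
abbreviation "deviation \<equiv> bellman_deviation M \<tau> \<phi>"

lemma V_beyond: "\<not> t < horizon M \<Longrightarrow> V \<beta> t s = 0"
  by (simp add: Vhat_def)

lemma EV_beyond: "\<not> Suc t < horizon M \<Longrightarrow> EV \<beta> t x = (\<lambda>_. 0)"
  by (simp add: EVhat_def fun_eq_iff V_beyond)

lemma V_measurable:
  "t < horizon M \<Longrightarrow> x \<in> endo M t \<Longrightarrow> (\<lambda>w. V \<beta> t (x, w)) \<in> borel_measurable (exo M t)"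
  by (simp add: Vhat_def)
    (intro borel_measurable_sum borel_measurable_times borel_measurable_const basis_measurable)

lemma V_integrable:
  "t < horizon M \<Longrightarrow> x \<in> endo M t \<Longrightarrow> integrable (law M) (\<lambda>w. V \<beta> t (x, w t))"
  by (simp add: Vhat_def del: Bochner_Integration.integrable_sum)
    (intro Bochner_Integration.integrable_sum integrable_mult_right basis_integrable)

lemma V_kernel_integrable:
  "Suc t < horizon M \<Longrightarrow> x \<in> endo M (Suc t) \<Longrightarrow> w \<in> space (exo M t) \<Longrightarrow>
    integrable (kernel M t w) (\<lambda>w'. V \<beta> (Suc t) (x, w'))"
  by (simp add: Vhat_def del: Bochner_Integration.integrable_sum)
    (intro Bochner_Integration.integrable_sum integrable_mult_right basis_kernel_integrable)

lemma EV_measurable: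
  "Suc t < horizon M \<Longrightarrow> x \<in> endo M (Suc t) \<Longrightarrow> EV \<beta> t x \<in> borel_measurable (exo M t)"
  unfolding EVhat_def[abs_def] by (rule measurable_transition[OF _ V_measurable])

lemma EV_conditional:
  assumes "Suc t < horizon M" "x \<in> endo M (Suc t)" "H \<in> sets (PiM {..t} (exo M))"
  defines "A \<equiv> {w \<in> space (law M). restrict w {..t} \<in> H}"
  shows "integrable (law M) (\<lambda>w. indicator A w * EV \<beta> t x (w t))"
    and "(\<integral>w. indicator A w * V \<beta> (Suc t) (x, w (Suc t)) \<partial>law M) =
         (\<integral>w. indicator A w * EV \<beta> t x (w t) \<partial>law M)"
  unfolding A_def EVhat_def
  by ((rule transition_integral[OF assms(1,3) V_measurable[OF assms(1,2)]
        V_integrable[OF assms(1,2)] V_kernel_integrable[OF assms(1,2)]], assumption)+)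

lemma EV_integrable:
  assumes "Suc t < horizon M" "x \<in> endo M (Suc t)"
  shows "integrable (law M) (\<lambda>w. EV \<beta> t x (w t))"
proof -
  have "restrict w {..t} \<in> space (PiM {..t} (exo M))" if "w \<in> space (law M)" for w
    using measurable_space[OF measurable_history that] assms(1) by simp
  then have "indicator {w \<in> space (law M). restrict w {..t} \<in> space (PiM {..t} (exo M))} w = (1::real)"
    if "w \<in> space (law M)" for w
    using that by simp
  then show ?thesis
    using EV_conditional(1)[OF assms sets.top, of \<beta>]
    by (simp cong: Bochner_Integration.integrable_cong)
qed

lemma V_next_integrable:
  "t < horizon M \<Longrightarrow> x \<in> endo M t \<Longrightarrow> a \<in> acts M t \<Longrightarrow>
    integrable (law M) (\<lambda>w. V \<beta> (Suc t) (next_x M x a, w (Suc t)))"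
  by (cases "Suc t < horizon M") (simp_all add: V_integrable next_x_in V_beyond)

lemma EV_next_measurable:
  "t < horizon M \<Longrightarrow> x \<in> endo M t \<Longrightarrow> a \<in> acts M t \<Longrightarrow>
    EV \<beta> t (next_x M x a) \<in> borel_measurable (exo M t)"
  by (cases "Suc t < horizon M") (simp_all add: EV_measurable next_x_in EV_beyond)

lemma EV_next_integrable:
  "t < horizon M \<Longrightarrow> x \<in> endo M t \<Longrightarrow> a \<in> acts M t \<Longrightarrow>
    integrable (law M) (\<lambda>w. EV \<beta> t (next_x M x a) (w t))"
  by (cases "Suc t < horizon M") (simp_all add: EV_integrable next_x_in EV_beyond)

lemma V_linear: "V (c *\<^sub>R \<beta> + d *\<^sub>R \<beta>') t s = c * V \<beta> t s + d * V \<beta>' t s"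
  by (simp add: Vhat_def sum.distrib sum_distrib_left algebra_simps)

lemma EV_next_linear:
  assumes "t < horizon M" "x \<in> endo M t" "a \<in> acts M t" "w \<in> space (exo M t)"
  shows "EV (c *\<^sub>R \<beta> + d *\<^sub>R \<beta>') t (next_x M x a) w =
    c * EV \<beta> t (next_x M x a) w + d * EV \<beta>' t (next_x M x a) w"
proof (cases "Suc t < horizon M")
  case True
  then have "integrable (kernel M t w) (\<lambda>w'. V \<beta> (Suc t) (next_x M x a, w'))" for \<beta>
    using assms by (intro V_kernel_integrable next_x_in)
  then show ?thesis
    by (simp add: EVhat_def V_linear)
qed (simp add: EV_beyond)

lemma innovation_mean_zero:
  fixes \<beta> :: "(real ^ 'b) ^ 't"
  assumes pol: "\<pi> \<in> policies M" and t: "t < horizon M"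
  defines "inno \<equiv> \<lambda>x w. V \<beta> (Suc t) (x, w (Suc t)) - EV \<beta> t x (w t)"
  defines "X \<equiv> \<lambda>w. policy_path M \<pi> w (Suc t)"
  shows "integrable (law M) (\<lambda>w. inno (X w) w)" (is ?I)
    and "(\<integral>w. inno (X w) w \<partial>law M) = 0" (is ?Z)
proof -
  have "?I \<and> ?Z"
  proof (cases "Suc t < horizon M")
    case False
    then show ?thesis
      by (simp add: inno_def V_beyond EV_beyond)
  next
    case True
    let ?I = "endo M (Suc t)"
    define A where "A x = {w \<in> space (law M). restrict w {..t} \<in>
      (\<lambda>w. policy_path M \<pi> w (Suc t)) -` {x} \<inter> space (PiM {..t} (exo M))}" for x
    have X: "X \<in> law M \<rightarrow>\<^sub>M count_space ?I"
      unfolding X_def measurable_cong_sets[OF sets_law refl]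
      by (rule measurable_policy_path[OF pol True]) (use True in auto)
    have X_hist: "(\<lambda>w. policy_path M \<pi> w (Suc t)) \<in> PiM {..t} (exo M) \<rightarrow>\<^sub>M count_space ?I"
      by (rule measurable_policy_path[OF pol True]) auto
    have inno_int: "integrable (law M) (inno x)" if "x \<in> ?I" for x
      unfolding inno_def using V_integrable[OF True that] EV_integrable[OF True that]
      by (rule Bochner_Integration.integrable_diff)
    have ind: "indicator (A x) w = (if X w = x then 1 else 0 :: real)" if "w \<in> space (law M)" for x w
    proof -
      have "policy_path M \<pi> (restrict w {..t}) (Suc t) = X w"
        unfolding X_def by (rule policy_path_cong) auto
      moreover have "restrict w {..t} \<in> space (PiM {..t} (exo M))"
        using measurable_space[OF measurable_history that] t by simp
      ultimately show ?thesis
        using that by (simp add: A_def indicator_def)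
    qed
    have mean: "integrable (law M) (\<lambda>w. indicator (A x) w * inno x w) \<and>
        (\<integral>w. indicator (A x) w * inno x w \<partial>law M) = 0" if x: "x \<in> ?I" for x
    proof -
      have H: "(\<lambda>w. policy_path M \<pi> w (Suc t)) -` {x} \<inter> space (PiM {..t} (exo M)) \<in>
          sets (PiM {..t} (exo M))"
        by (rule measurable_sets[OF X_hist]) (use x in simp)
      have A: "A x \<in> sets (law M)"
        unfolding A_def by (rule history_event[OF t H])
      have i1: "integrable (law M) (\<lambda>w. indicator (A x) w * V \<beta> (Suc t) (x, w (Suc t)))"
        using integrable_real_mult_indicator[OF A V_integrable[OF True x]]
        by (simp only: mult.commute[of _ "indicator _ _"])
      note i2 = EV_conditional[OF True x H, folded A_def]
      show ?thesis
        unfolding inno_def right_diff_distrib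
        using i1 i2(1)[of \<beta>] i2(2)[of \<beta>] by simp
    qed
    have sum_eq: "inno (X w) w = (\<Sum>x\<in>?I. indicator (A x) w * inno x w)" if "w \<in> space (law M)" for w
      using measurable_space[OF X that] finite_endo[OF True]
      by (simp add: ind[OF that] if_distrib[of "\<lambda>c. c * _"] sum.delta cong: if_cong)
    have "(\<integral>w. inno (X w) w \<partial>law M) = (\<integral>w. (\<Sum>x\<in>?I. indicator (A x) w * inno x w) \<partial>law M)"
      by (rule Bochner_Integration.integral_cong) (auto simp: sum_eq)
    also have "\<dots> = 0"
      using mean by (subst Bochner_Integration.integral_sum) auto
    finally show ?thesis
      using integrable_finite_choice[OF finite_endo[OF True] X inno_int] by simp
  qed
  then show ?I ?Z by auto
qed

lemma residual_measurable:
  "t < horizon M \<Longrightarrow> x \<in> endo M t \<Longrightarrow> a \<in> acts M t \<Longrightarrow>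
    residual \<beta> t x a \<in> borel_measurable (exo M t)"
  unfolding bellman_residual_def[abs_def]
  using reward_measurable EV_next_measurable V_measurable
  by (intro borel_measurable_diff borel_measurable_add borel_measurable_times borel_measurable_const)

lemma residual_integrable:
  "t < horizon M \<Longrightarrow> x \<in> endo M t \<Longrightarrow> a \<in> acts M t \<Longrightarrow>
    integrable (law M) (\<lambda>w. residual \<beta> t x a (w t))"
  unfolding bellman_residual_def[abs_def]
  using reward_integrable EV_next_integrable V_integrable
  by (intro Bochner_Integration.integrable_diff Bochner_Integration.integrable_add
      integrable_mult_right) auto

lemma deviation_eq_MAX:
  "deviation \<beta> t w = (MAX i\<in>endo M t \<times> acts M t. residual \<beta> t (fst i) (snd i) w)"
  by (simp add: bellman_deviation_def case_prod_beta)

lemma residual_le_deviation: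
  "t < horizon M \<Longrightarrow> x \<in> endo M t \<Longrightarrow> a \<in> acts M t \<Longrightarrow> residual \<beta> t x a w \<le> deviation \<beta> t w"
  unfolding bellman_deviation_def using finite_endo finite_acts by (intro Max_ge) force+

lemma deviation_le_iff:
  assumes "t < horizon M"
  shows "deviation \<beta> t w \<le> c \<longleftrightarrow> (\<forall>x\<in>endo M t. \<forall>a\<in>acts M t. residual \<beta> t x a w \<le> c)"
  unfolding bellman_deviation_def
  using finite_endo[OF assms] finite_acts[OF assms] endo_nonempty[OF assms] acts_nonempty[OF assms]
  by (subst Max_le_iff) auto

lemma deviation_measurable: "t < horizon M \<Longrightarrow> deviation \<beta> t \<in> borel_measurable (exo M t)"
  unfolding deviation_eq_MAX[abs_def]
  using finite_endo finite_acts residual_measurable by (intro borel_measurable_Max) auto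

lemma deviation_integrable: "t < horizon M \<Longrightarrow> integrable (law M) (\<lambda>w. deviation \<beta> t (w t))"
  unfolding deviation_eq_MAX
  using finite_endo finite_acts endo_nonempty acts_nonempty residual_integrable
  by (intro integrable_MAX) auto

abbreviation "action_plans \<equiv> \<Pi>\<^sub>E t\<in>{..<horizon M}. acts M t"

definition penalized_payoff ::
    "(real ^ 'b) ^ 't \<Rightarrow> (nat \<Rightarrow> 'a) \<Rightarrow> (nat \<Rightarrow> 'w) \<Rightarrow> real" where
  "penalized_payoff \<beta> a w = (\<Sum>t<horizon M. discount M ^ t *
     (reward M t (action_path M a t, w t) (a t)
      - discount M * (V \<beta> (Suc t) (action_path M a (Suc t), w (Suc t))
                      - EV \<beta> t (action_path M a (Suc t)) (w t))))"

lemma F_PO_eq: "F_PO M \<tau> \<phi> \<beta> = (\<integral>w. (MAX a\<in>action_plans. penalized_payoff \<beta> a w) \<partial>law M)"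
  by (simp add: F_PO_def penalized_payoff_def)

lemma finite_action_plans: "finite action_plans"
  using finite_acts by (intro finite_PiE) auto

lemma action_plans_nonempty: "action_plans \<noteq> {}"
  using acts_nonempty by (simp add: PiE_eq_empty_iff)

lemma penalized_payoff_integrable:
  assumes a: "a \<in> action_plans"
  shows "integrable (law M) (penalized_payoff \<beta> a)"
  unfolding penalized_payoff_def[abs_def]
proof (intro Bochner_Integration.integrable_sum integrable_mult_right
    Bochner_Integration.integrable_diff)
  fix t assume "t \<in> {..<horizon M}"
  then have t: "t < horizon M" "action_path M a t \<in> endo M t" "a t \<in> acts M t"
    using action_path_in[OF a] a by (auto simp: PiE_mem)
  show "integrable (law M) (\<lambda>w. reward M t (action_path M a t, w t) (a t))"
    by (rule reward_integrable[OF t])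
  show "integrable (law M) (\<lambda>w. V \<beta> (Suc t) (action_path M a (Suc t), w (Suc t)))"
    using V_next_integrable[OF t] by simp
  show "integrable (law M) (\<lambda>w. EV \<beta> t (action_path M a (Suc t)) (w t))"
    using EV_next_integrable[OF t] by simp
qed

lemma max_penalized_payoff_integrable:
  "integrable (law M) (\<lambda>w. MAX a\<in>action_plans. penalized_payoff \<beta> a w)"
  by (rule integrable_MAX[OF finite_action_plans action_plans_nonempty penalized_payoff_integrable])

lemma policy_value_le_F_PO:
  assumes pol: "\<pi> \<in> policies M"
  shows "policy_value M \<pi> \<le> F_PO M \<tau> \<phi> \<beta>"
proof -
  let ?x = "policy_path M \<pi>"
  define act where "act t w = \<pi> t (?x w t, w t)" for t w
  define inno where "inno t w = V \<beta> (Suc t) (?x w (Suc t), w (Suc t)) - EV \<beta> t (?x w (Suc t)) (w t)"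
    for t w
  define rew where "rew t w = reward M t (?x w t, w t) (act t w)" for t w
  have x: "(\<lambda>w. ?x w t) \<in> law M \<rightarrow>\<^sub>M count_space (endo M t)"
    and act: "act t \<in> law M \<rightarrow>\<^sub>M count_space (acts M t)" if "t < horizon M" for t
    unfolding measurable_cong_sets[OF sets_law refl] act_def[abs_def]
    by (rule measurable_policy_path[OF pol that] measurable_policy_action[OF pol that];
        use that in auto)+
  have inno: "integrable (law M) (inno t)" "(\<integral>w. inno t w \<partial>law M) = 0" if "t < horizon M" for t
    using innovation_mean_zero[OF pol that, of \<beta>] by (simp_all only: inno_def[abs_def])
  have rew: "integrable (law M) (rew t)" if t: "t < horizon M" for t
  proof -
    have sel: "integrable (law M) (\<lambda>w. reward M t (x, w t) (act t w))" if "x \<in> endo M t" for x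
      by (rule integrable_finite_choice[OF finite_acts[OF t] act[OF t],
            where f = "\<lambda>a w. reward M t (x, w t) a"]) (rule reward_integrable[OF t that])
    show ?thesis
      unfolding rew_def[abs_def]
      by (rule integrable_finite_choice[OF finite_endo[OF t] x[OF t],
            where f = "\<lambda>x w. reward M t (x, w t) (act t w)"]) (rule sel)
  qed
  have int: "integrable (law M) (\<lambda>w. \<Sum>t<horizon M. discount M ^ t * (rew t w - discount M * inno t w))"
    using rew inno(1)
    by (intro Bochner_Integration.integrable_sum integrable_mult_right
        Bochner_Integration.integrable_diff) auto
  have "policy_value M \<pi> = (\<integral>w. (\<Sum>t<horizon M. discount M ^ t * rew t w) \<partial>law M)"
    by (simp add: policy_value_def rew_def act_def Let_def)
  also have "\<dots> = (\<Sum>t<horizon M. discount M ^ t * (\<integral>w. rew t w \<partial>law M))"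
    using rew by (subst Bochner_Integration.integral_sum) auto
  also have "\<dots> = (\<Sum>t<horizon M. discount M ^ t * (\<integral>w. rew t w - discount M * inno t w \<partial>law M))"
    using rew inno by (intro sum.cong) auto
  also have "\<dots> = (\<integral>w. (\<Sum>t<horizon M. discount M ^ t * (rew t w - discount M * inno t w)) \<partial>law M)"
    using rew inno(1) by (subst Bochner_Integration.integral_sum) auto
  also have "\<dots> \<le> (\<integral>w. (MAX a\<in>action_plans. penalized_payoff \<beta> a w) \<partial>law M)"
  proof (rule integral_mono[OF int max_penalized_payoff_integrable])
    fix w assume w: "w \<in> space (law M)"
    let ?a = "\<lambda>t\<in>{..<horizon M}. act t w"
    have plan: "?a \<in> action_plans"
      using measurable_space[OF act w] by auto
    have path: "action_path M ?a t = ?x w t" if "t \<le> horizon M" for t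
      using action_path_cong[of t ?a "\<lambda>t. act t w"] that
      by (simp add: act_def action_path_policy)
    have payoff: "penalized_payoff \<beta> ?a w =
        (\<Sum>t<horizon M. discount M ^ t * (rew t w - discount M * inno t w))"
      unfolding penalized_payoff_def
    proof (rule sum.cong[OF refl])
      fix t assume "t \<in> {..<horizon M}"
      then have "action_path M ?a t = ?x w t" "action_path M ?a (Suc t) = ?x w (Suc t)" "?a t = act t w"
        using path[of t] path[of "Suc t"] by simp_all
      then show "discount M ^ t * (reward M t (action_path M ?a t, w t) (?a t)
          - discount M * (V \<beta> (Suc t) (action_path M ?a (Suc t), w (Suc t))
                      - EV \<beta> t (action_path M ?a (Suc t)) (w t))) =
          discount M ^ t * (rew t w - discount M * inno t w)"
        by (simp only: rew_def inno_def)
    qed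
    show "(\<Sum>t<horizon M. discount M ^ t * (rew t w - discount M * inno t w))
        \<le> (MAX a\<in>action_plans. penalized_payoff \<beta> a w)"
      unfolding payoff[symmetric] using finite_action_plans plan by (intro Max_ge) blast+
  qed
  finally show ?thesis
    by (simp only: F_PO_eq)
qed

lemma penalized_payoff_le:
  assumes a: "a \<in> action_plans"
  shows "penalized_payoff \<beta> a w \<le>
    V \<beta> 0 (init_x M, w 0) + (\<Sum>t<horizon M. discount M ^ t * deviation \<beta> t (w t))"
proof -
  let ?V = "\<lambda>t. discount M ^ t * V \<beta> t (action_path M a t, w t)"
  let ?R = "\<lambda>t. discount M ^ t * residual \<beta> t (action_path M a t) (a t) (w t)"
  have "penalized_payoff \<beta> a w = (\<Sum>t<horizon M. ?R t + (?V t - ?V (Suc t)))"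
    unfolding penalized_payoff_def
    by (rule sum.cong) (simp_all add: bellman_residual_def algebra_simps)
  also have "\<dots> = (\<Sum>t<horizon M. ?R t) + (?V 0 - ?V (horizon M))"
    unfolding sum.distrib sum_lessThan_telescope'[of ?V] ..
  also have "\<dots> = V \<beta> 0 (init_x M, w 0) + (\<Sum>t<horizon M. ?R t)"
    by (simp add: V_beyond)
  also have "(\<Sum>t<horizon M. ?R t) \<le> (\<Sum>t<horizon M. discount M ^ t * deviation \<beta> t (w t))"
    using discount_pos action_path_in[OF a] a
    by (intro sum_mono mult_left_mono residual_le_deviation) (auto simp: PiE_mem)
  finally show ?thesis
    by simp
qed

lemma F_PO_le_F_WTCA: "F_PO M \<tau> \<phi> \<beta> \<le> F_WTCA M \<tau> \<phi> \<beta>"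
proof -
  let ?v = "V \<beta> 0 (init_x M, init_w M)"
  have dev: "integrable (law M) (\<lambda>w. \<Sum>t<horizon M. discount M ^ t * deviation \<beta> t (w t))"
    using deviation_integrable by (intro Bochner_Integration.integrable_sum integrable_mult_right) auto
  have "F_PO M \<tau> \<phi> \<beta> \<le> (\<integral>w. ?v + (\<Sum>t<horizon M. discount M ^ t * deviation \<beta> t (w t)) \<partial>law M)"
    unfolding F_PO_eq
  proof (rule integral_mono_AE[OF max_penalized_payoff_integrable])
    show "integrable (law M) (\<lambda>w. ?v + (\<Sum>t<horizon M. discount M ^ t * deviation \<beta> t (w t)))"
      using dev by simp
    show "AE w in law M. (MAX a\<in>action_plans. penalized_payoff \<beta> a w)
        \<le> ?v + (\<Sum>t<horizon M. discount M ^ t * deviation \<beta> t (w t))"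
      using law_init
    proof eventually_elim
      case (elim w)
      then show ?case
        using penalized_payoff_le[of _ \<beta> w] finite_action_plans action_plans_nonempty
        by (subst Max_le_iff) auto
    qed
  qed
  also have "\<dots> = ?v + (\<integral>w. (\<Sum>t<horizon M. discount M ^ t * deviation \<beta> t (w t)) \<partial>law M)"
    using dev by (simp add: law.prob_space)
  also have "\<dots> = F_WTCA M \<tau> \<phi> \<beta>"
    unfolding F_WTCA_def using deviation_integrable by (subst Bochner_Integration.integral_sum) auto
  finally show ?thesis .
qed

lemma F_WTCA_le_ALP:
  assumes "\<beta> \<in> feasible (ALP M \<tau> \<phi> \<Omega>)"
  shows "F_WTCA M \<tau> \<phi> \<beta> \<le> objective (ALP M \<tau> \<phi> \<Omega>) \<beta>"
proof -
  have "(\<integral>w. deviation \<beta> t (w t) \<partial>law M) \<le> 0" if "t < horizon M" for t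
  proof -
    have "(\<integral>w. deviation \<beta> t (w t) \<partial>law M) \<le> (\<integral>w. 0 \<partial>law M)"
      using assms that law_stage_in[OF that]
      by (intro integral_mono deviation_integrable) (simp_all add: ALP_def)
    then show ?thesis
      by simp
  qed
  then have "(\<Sum>t<horizon M. discount M ^ t * (\<integral>w. deviation \<beta> t (w t) \<partial>law M)) \<le> 0"
    using discount_pos by (intro sum_nonpos mult_nonneg_nonpos) auto
  then show ?thesis
    by (simp add: F_WTCA_def ALP_def)
qed

lemma slack_integrable:
  "\<theta> \<in> slack_space M \<Longrightarrow> t < horizon M \<Longrightarrow> integrable (law M) (\<lambda>w. \<theta> t (w t))"
  by (simp add: slack_space_def)

lemma function_subspace_slack_space: "function_subspace (slack_space M)"
  unfolding function_subspace_def lincomb_def slack_space_def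
  by (auto intro!: borel_measurable_add borel_measurable_times)

lemma linear_form_on_objective_WTCA_LP:
  "linear_form_on (slack_space M) (objective (WTCA_LP M \<tau> \<phi> \<Omega>))"
  unfolding linear_form_on_def
proof (intro allI ballI)
  fix c d \<beta> \<beta>' \<theta> \<theta>' assume \<theta>: "\<theta> \<in> slack_space M" "\<theta>' \<in> slack_space M"
  have "(\<integral>w. c * \<theta> t (w t) + d * \<theta>' t (w t) \<partial>law M) =
      c * (\<integral>w. \<theta> t (w t) \<partial>law M) + d * (\<integral>w. \<theta>' t (w t) \<partial>law M)" if "t < horizon M" for t
    using slack_integrable[OF \<theta>(1) that] slack_integrable[OF \<theta>(2) that] by simp
  then have "(\<Sum>t<horizon M. discount M ^ t * (\<integral>w. c * \<theta> t (w t) + d * \<theta>' t (w t) \<partial>law M)) =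
      c * (\<Sum>t<horizon M. discount M ^ t * (\<integral>w. \<theta> t (w t) \<partial>law M)) +
      d * (\<Sum>t<horizon M. discount M ^ t * (\<integral>w. \<theta>' t (w t) \<partial>law M))"
    by (simp add: sum_distrib_left algebra_simps sum.distrib)
  then show "objective (WTCA_LP M \<tau> \<phi> \<Omega>) (c *\<^sub>R \<beta> + d *\<^sub>R \<beta>', lincomb c \<theta> d \<theta>') =
      c * objective (WTCA_LP M \<tau> \<phi> \<Omega>) (\<beta>, \<theta>) + d * objective (WTCA_LP M \<tau> \<phi> \<Omega>) (\<beta>', \<theta>')"
    by (simp add: WTCA_LP_def lincomb_def V_linear algebra_simps)
qed

lemma linear_program_WTCA_LP: "linear_program \<Omega> (WTCA_LP M \<tau> \<phi> \<Omega>)"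
proof -
  define g where "g t w x a = (\<lambda>(\<beta>, \<theta>).
    discount M * EV \<beta> t (next_x M x a) w - V \<beta> t (x, w) - \<theta> t w)" for t w x a
  define C where "C = {(g t w x a, - reward M t (x, w) a) | t w x a.
    t < horizon M \<and> w \<in> space (exo M t) \<and> x \<in> endo M t \<and> a \<in> acts M t}"
  have "\<forall>(g, d)\<in>C. linear_form_on (slack_space M) g"
    by (auto simp: C_def g_def linear_form_on_def lincomb_def V_linear EV_next_linear algebra_simps)
  moreover have "feasible (WTCA_LP M \<tau> \<phi> \<Omega>) =
      {(\<beta>, \<theta>). \<beta> \<in> \<Omega> \<and> \<theta> \<in> slack_space M \<and> (\<forall>(g, d)\<in>C. g (\<beta>, \<theta>) \<le> d)}"
  proof -
    have "residual \<beta> t x a w \<le> \<theta> t w \<longleftrightarrow> g t w x a (\<beta>, \<theta>) \<le> - reward M t (x, w) a" for \<beta> \<theta> t x a w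
      by (auto simp: g_def bellman_residual_def)
    then show ?thesis
      unfolding WTCA_LP_def C_def by auto blast+
  qed
  ultimately show ?thesis
    unfolding linear_program_def
    using function_subspace_slack_space linear_form_on_objective_WTCA_LP by blast
qed

lemma WTCA_LP_deviation:
  assumes "\<beta> \<in> \<Omega>"
  shows "(\<beta>, deviation \<beta>) \<in> feasible (WTCA_LP M \<tau> \<phi> \<Omega>)"
    and "objective (WTCA_LP M \<tau> \<phi> \<Omega>) (\<beta>, deviation \<beta>) = F_WTCA M \<tau> \<phi> \<beta>"
  using assms deviation_measurable deviation_integrable residual_le_deviation
  by (auto simp: WTCA_LP_def slack_space_def F_WTCA_def)

lemma F_WTCA_le_objective_WTCA_LP:
  assumes "(\<beta>, \<theta>) \<in> feasible (WTCA_LP M \<tau> \<phi> \<Omega>)"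
  shows "F_WTCA M \<tau> \<phi> \<beta> \<le> objective (WTCA_LP M \<tau> \<phi> \<Omega>) (\<beta>, \<theta>)"
proof -
  have le: "deviation \<beta> t w \<le> \<theta> t w" if "t < horizon M" "w \<in> space (exo M t)" for t w
    using assms that by (auto simp: WTCA_LP_def deviation_le_iff)
  have "(\<integral>w. deviation \<beta> t (w t) \<partial>law M) \<le> (\<integral>w. \<theta> t (w t) \<partial>law M)" if "t < horizon M" for t
    using assms
    by (intro integral_mono deviation_integrable that slack_integrable le law_stage_in)
      (auto simp: WTCA_LP_def)
  then have "(\<Sum>t<horizon M. discount M ^ t * (\<integral>w. deviation \<beta> t (w t) \<partial>law M))
      \<le> (\<Sum>t<horizon M. discount M ^ t * (\<integral>w. \<theta> t (w t) \<partial>law M))"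
    using discount_pos by (intro sum_mono mult_left_mono) auto
  then show ?thesis
    by (simp add: F_WTCA_def WTCA_LP_def)
qed

end

theorem proposition2:
  fixes M :: "('x, 'w, 'a) mdp"
    and \<tau> :: "nat \<Rightarrow> 't::finite"
    and \<phi> :: "nat \<Rightarrow> 'b::finite \<Rightarrow> 'x \<times> 'w \<Rightarrow> real"
    and \<Omega> :: "((real ^ 'b) ^ 't) set"
  assumes "vfa M \<tau> \<phi>"
    and "admissible_parameter_set M \<tau> \<phi> \<Omega>"
  shows "(linear_program \<Omega> (WTCA_LP M \<tau> \<phi> \<Omega>) \<and>
          equivalent_with_aux (WTCA M \<tau> \<phi> \<Omega>) (WTCA_LP M \<tau> \<phi> \<Omega>) \<and>
          relaxation_with_aux (WTCA_LP M \<tau> \<phi> \<Omega>) (ALP M \<tau> \<phi> \<Omega>) \<and>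
          V0_opt M \<le> opt_val (WTCA M \<tau> \<phi> \<Omega>) \<and>
          opt_val (WTCA M \<tau> \<phi> \<Omega>) \<le> opt_val (ALP M \<tau> \<phi> \<Omega>)) \<and>
         (V0_opt M \<le> opt_val (PO M \<tau> \<phi> \<Omega>) \<and>
          (\<forall>\<beta>W \<in> argmin (WTCA M \<tau> \<phi> \<Omega>).
             opt_val (PO M \<tau> \<phi> \<Omega>) \<le> ereal (F_PO M \<tau> \<phi> \<beta>W) \<and>
             ereal (F_PO M \<tau> \<phi> \<beta>W) \<le> opt_val (WTCA M \<tau> \<phi> \<Omega>)))"
proof -
  interpret vfa M \<tau> \<phi> by fact
  have WTCA: "feasible (WTCA M \<tau> \<phi> \<Omega>) = \<Omega>" "objective (WTCA M \<tau> \<phi> \<Omega>) = F_WTCA M \<tau> \<phi>"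
    and PO: "feasible (PO M \<tau> \<phi> \<Omega>) = \<Omega>" "objective (PO M \<tau> \<phi> \<Omega>) = F_PO M \<tau> \<phi>"
    by (simp_all add: WTCA_def PO_def)
  have ALP: "\<beta> \<in> \<Omega>" if "\<beta> \<in> feasible (ALP M \<tau> \<phi> \<Omega>)" for \<beta>
    using that by (simp add: ALP_def)
  have eq: "equivalent_with_aux (WTCA M \<tau> \<phi> \<Omega>) (WTCA_LP M \<tau> \<phi> \<Omega>)"
    unfolding equivalent_with_aux_def WTCA
  proof (intro conjI allI impI ballI)
    show "\<beta> \<in> \<Omega>" if "(\<beta>, \<theta>) \<in> feasible (WTCA_LP M \<tau> \<phi> \<Omega>)" for \<beta> \<theta>
      using that by (simp add: WTCA_LP_def)
  qed (use F_WTCA_le_objective_WTCA_LP WTCA_LP_deviation in blast)+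
  have relax: "relaxation_with_aux (WTCA_LP M \<tau> \<phi> \<Omega>) (ALP M \<tau> \<phi> \<Omega>)"
    unfolding relaxation_with_aux_def
  proof
    fix \<beta> assume \<beta>: "\<beta> \<in> feasible (ALP M \<tau> \<phi> \<Omega>)"
    show "\<exists>\<theta>. (\<beta>, \<theta>) \<in> feasible (WTCA_LP M \<tau> \<phi> \<Omega>) \<and>
        objective (WTCA_LP M \<tau> \<phi> \<Omega>) (\<beta>, \<theta>) \<le> objective (ALP M \<tau> \<phi> \<Omega>) \<beta>"
      using WTCA_LP_deviation[OF ALP[OF \<beta>]] F_WTCA_le_ALP[OF \<beta>]
      by (intro exI[of _ "bellman_deviation M \<tau> \<phi> \<beta>"]) simp
  qed
  have V_PO: "V0_opt M \<le> opt_val (PO M \<tau> \<phi> \<Omega>)"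
    unfolding V0_opt_def opt_val_def PO
    by (intro SUP_least INF_greatest) (simp add: policy_value_le_F_PO)
  have PO_WTCA: "opt_val (PO M \<tau> \<phi> \<Omega>) \<le> opt_val (WTCA M \<tau> \<phi> \<Omega>)"
    unfolding opt_val_def PO WTCA by (intro INF_mono) (auto intro: F_PO_le_F_WTCA)
  have WTCA_ALP: "opt_val (WTCA M \<tau> \<phi> \<Omega>) \<le> opt_val (ALP M \<tau> \<phi> \<Omega>)"
    unfolding opt_val_def WTCA by (intro INF_mono) (use ALP F_WTCA_le_ALP in auto)
  have "opt_val (PO M \<tau> \<phi> \<Omega>) \<le> ereal (F_PO M \<tau> \<phi> \<beta>) \<and>
      ereal (F_PO M \<tau> \<phi> \<beta>) \<le> opt_val (WTCA M \<tau> \<phi> \<Omega>)" if \<beta>: "\<beta> \<in> argmin (WTCA M \<tau> \<phi> \<Omega>)" for \<beta>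
  proof
    have "\<beta> \<in> \<Omega>" "\<And>u. u \<in> \<Omega> \<Longrightarrow> F_WTCA M \<tau> \<phi> \<beta> \<le> F_WTCA M \<tau> \<phi> u"
      using \<beta> by (simp_all add: argmin_def WTCA)
    then show "opt_val (PO M \<tau> \<phi> \<Omega>) \<le> ereal (F_PO M \<tau> \<phi> \<beta>)"
      and "ereal (F_PO M \<tau> \<phi> \<beta>) \<le> opt_val (WTCA M \<tau> \<phi> \<Omega>)"
      unfolding opt_val_def PO WTCA
      by (auto intro!: INF_lower INF_greatest order_trans[OF F_PO_le_F_WTCA])
  qed
  then show ?thesis
    using linear_program_WTCA_LP eq relax order_trans[OF V_PO PO_WTCA] WTCA_ALP V_PO by blast
qed

end
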